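(* Fix a constant $\delta\in(0,1)$. There is a constant $c_\delta>0$ depending only on $\delta$ such that the following holds. For every line consisting of $n$ equidistant sites and every positive integer buffer size $k$, there exists an input sequence of requests on which \[ \frac{\mathrm{cost}\big(\mathrm{OPT}((1-\delta)\cdot k)\big)}{\mathrm{cost}\big(\mathrm{OPT}(k)\big)}\;\ge\; c_\delta\cdot \min\{k,\log n\}. \] In words, the ratio between the costs of $\mathrm{OPT}(k)$ and $\mathrm{OPT}((1-\delta)\cdot k)$ is $\Omega(\min\{k,\log n\})$.
   Context: Reordering buffer problem: requests arrive online, one at a time, each at a point of a metric space. An algorithm has a single server located at a point of the metric space and a buffer of capacity $s$. At any time there can be at most $s$ unprocessed requests; once their number is exactly $s$, the algorithm must move its server to the position of a pending request of its choice, which is then served and removed from the buffer (a request at the current server position may be served without cost). After the input ends, all remaining pending requests must be served. The cost of an algorithm is the total distance traveled by the server. $\mathrm{OPT}(s)$ denotes an optimal offline algorithm (knowing the whole input in advance) with buffer capacity $s$, and $\mathrm{cost}(\mathrm{OPT}(s))$ its cost on the given input. The line of $n$ equidistant sites is the metric on sites $0,1,\dots,n-1$ with distance $|i-j|$. *)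

theory Defs
  imports Complex_Main "HOL-Library.Multiset"
begin

text \<open>
  \<open>run d s p B rs c\<close>: in the metric \<open>d\<close>, with buffer capacity \<open>s\<close>, server at \<open>p\<close>, pending
  requests \<open>B\<close> and future requests \<open>rs\<close>, all requests can be served with total travelled
  distance \<open>c\<close>. The rule that a request must be served once the buffer holds exactly \<open>s\<close> requests
  is expressed by letting a new request arrive only while fewer than \<open>s\<close> are pending. A run ends
  only when the input is exhausted and the buffer is empty.
\<close>

inductive run :: "('a \<Rightarrow> 'a \<Rightarrow> real) \<Rightarrow> nat \<Rightarrow> 'a \<Rightarrow> 'a multiset \<Rightarrow> 'a list \<Rightarrow> real \<Rightarrow> bool"
  for d :: "'a \<Rightarrow> 'a \<Rightarrow> real" and s :: nat where
  finished: "run d s p {#} [] 0"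
| arrive: "size B < s \<Longrightarrow> run d s p (add_mset r B) rs c \<Longrightarrow> run d s p B (r # rs) c"
| serve: "run d s q B rs c \<Longrightarrow> run d s p (add_mset q B) rs (d p q + c)"

definition opt_cost :: "('a \<Rightarrow> 'a \<Rightarrow> real) \<Rightarrow> nat \<Rightarrow> 'a \<Rightarrow> 'a list \<Rightarrow> real" where
  "opt_cost d s p rs = Inf {c. run d s p {#} rs c}"

definition line_dist :: "nat \<Rightarrow> nat \<Rightarrow> real" where
  "line_dist i j = \<bar>real i - real j\<bar>"

text \<open>For positive capacity the infimum is a minimum, so \<open>opt_cost\<close> is the cost of an optimal
  offline algorithm.\<close>

lemma finite_run_costs: "finite {c. run d s p B rs c}"
proof (induction "2 * length rs + size B" arbitrary: p B rs rule: less_induct)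
  case less
  let ?A = "case rs of [] \<Rightarrow> {} | r # rs' \<Rightarrow> {c. run d s p (add_mset r B) rs' c}"
  let ?S = "\<Union>q\<in>set_mset B. (\<lambda>c. d p q + c) ` {c. run d s q (B - {#q#}) rs c}"
  have "finite ?A"
    by (cases rs) (simp_all add: less)
  moreover have "finite ?S"
  proof (intro finite_UN_I finite_imageI)
    fix q assume "q \<in># B"
    then have "size (B - {#q#}) < size B"
      by (metis insert_DiffM lessI size_add_mset)
    then show "finite {c. run d s q (B - {#q#}) rs c}"
      using less by simp
  qed simp
  moreover have "{c. run d s p B rs c} \<subseteq> {0} \<union> ?A \<union> ?S"
  proof
    fix c assume "c \<in> {c. run d s p B rs c}"
    then have "run d s p B rs c" by simp
    then show "c \<in> {0} \<union> ?A \<union> ?S"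
      by cases auto
  qed
  ultimately show ?case
    by (meson finite.emptyI finite.insertI finite_UnI finite_subset)
qed

lemma run_exists:
  assumes "0 < s"
  shows "\<exists>c. run d s p {#} rs c"
proof (induction rs arbitrary: p)
  case Nil
  show ?case by (rule exI, rule run.finished)
next
  case (Cons r rs)
  then obtain c where "run d s r {#} rs c" by blast
  then have "run d s p {#} (r # rs) (d p r + c)"
    using assms by (intro run.arrive run.serve) simp_all
  then show ?case by blast
qed

lemma
  assumes "0 < s"
  shows opt_cost_attained: "run d s p {#} rs (opt_cost d s p rs)"
    and opt_cost_le: "run d s p {#} rs c \<Longrightarrow> opt_cost d s p rs \<le> c"
proof -
  let ?C = "{c. run d s p {#} rs c}"
  have fin: "finite ?C" by (rule finite_run_costs)
  have ne: "?C \<noteq> {}" using run_exists[OF assms, of d p rs] by simp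
  have eq: "opt_cost d s p rs = Min ?C"
    unfolding opt_cost_def using fin ne by (rule cInf_eq_Min)
  show "run d s p {#} rs (opt_cost d s p rs)"
    using Min_in[OF fin ne] eq by simp
  show "opt_cost d s p rs \<le> c" if "run d s p {#} rs c"
    using Min_le[OF fin, of c] that eq by simp
qed

lemma run_mono: "run d s p B rs c \<Longrightarrow> s \<le> t \<Longrightarrow> run d t p B rs c"
proof (induction rule: run.induct)
  case finished
  show ?case by (rule run.finished)
next
  case arrive
  then show ?case by (intro run.arrive) simp_all
next
  case serve
  then show ?case by (intro run.serve) simp
qed

lemma opt_cost_antimono:
  assumes "0 < s" and "s \<le> t"
  shows "opt_cost d t p rs \<le> opt_cost d s p rs"
  using assms by (intro opt_cost_le run_mono[OF opt_cost_attained]) simp_all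

end

theory Submission
  imports Defs
begin

text \<open>
  The server of the large buffer sweeps once over \<open>N = 2 ^ e\<close> sites. At every time \<open>t < N\<close> and for each
  of \<open>l\<close> levels \<open>i\<close> it holds \<open>m\<close> requests at the next multiple of \<open>2 ^ i\<close> after \<open>t\<close>, which arrived at
  the previous multiple; here \<open>m * l\<close> is slightly less than \<open>k\<close>. In addition so many requests arrive
  at \<open>t\<close> itself that the small buffer has to visit \<open>t\<close> at time \<open>t\<close>. Lacking \<open>\<delta> * k\<close> places, at all
  times it must have served a constant fraction of the levels early, by excursions ahead of the sweep.
  Except for a small fraction of the times, the next multiple of \<open>2 ^ i\<close> is \<open>\<Omega>(2 ^ i)\<close> away, so an
  excursion of length \<open>L\<close> reaches only the levels with \<open>2 ^ i = O(L)\<close>, and each of these benefits for at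
  most \<open>2 ^ i\<close> time steps, \<open>O(L)\<close> in total. As \<open>\<Omega>(l * N)\<close> pairs of a time and a level have to
  benefit, the excursions have total length \<open>\<Omega>(l * N)\<close>, whereas the sweep costs \<open>O(N)\<close>.
\<close>

section \<open>Runs on the line\<close>

lemma line_dist_triangle: "line_dist a c \<le> line_dist a b + line_dist b c"
  by (simp add: line_dist_def)

lemma line_dist_self [simp]: "line_dist a a = 0"
  by (simp add: line_dist_def)

lemma line_dist_nonneg [simp]: "0 \<le> line_dist a b"
  by (simp add: line_dist_def)

lemma run_cost_nonneg: "run line_dist s p B rs c \<Longrightarrow> 0 \<le> c"
  by (induction rule: run.induct) auto

lemma run_cost_ge_dist:
  "run line_dist s p B rs c \<Longrightarrow> q \<in># B + mset rs \<Longrightarrow> line_dist p q \<le> c"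
proof (induction rule: run.induct)
  case (serve q' B rs c p)
  show ?case
  proof (cases "q = q'")
    case True
    then show ?thesis using run_cost_nonneg[OF serve.hyps] by simp
  next
    case False
    then have "line_dist q' q \<le> c" using serve by simp
    then show ?thesis using line_dist_triangle[of p q q'] by simp
  qed
qed auto

text \<open>Cuts the run just before the first request of \<open>ys\<close> arrives, or at its end.
  \<open>Z\<close> holds what was served before the cut: the server stood at each such site and then
  moved on to \<open>p'\<close>, hence the distance bounds.\<close>

lemma run_split_append:
  assumes "run line_dist s p B (xs @ ys) c" and "size B \<le> s"
  shows "\<exists>p' B' Z c1 c2. run line_dist s p' B' ys c2 \<and> c = c1 + c2 \<and> size B' \<le> s \<and>
           B + mset xs = B' + Z \<and> line_dist p p' \<le> c1 \<and> (\<forall>q\<in>#Z. line_dist q p' \<le> c1)"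
  using assms
proof (induction p B "xs @ ys" c arbitrary: xs rule: run.induct)
  case (finished p)
  then show ?case
    by (intro exI[of _ p] exI[of _ "{#}"] exI[of _ 0]) (auto intro: run.finished)
next
  case (arrive B p r rs c)
  show ?case
  proof (cases xs)
    case Nil
    then have "run line_dist s p B ys c"
      using run.arrive[OF arrive.hyps(1,2)] arrive.hyps(4) by simp
    then show ?thesis using Nil arrive.prems
      by (intro exI[of _ p] exI[of _ B] exI[of _ "{#}"] exI[of _ 0] exI[of _ c]) simp
  next
    case (Cons r' xs')
    then have "rs = xs' @ ys" "r' = r" using arrive.hyps(4) by auto
    moreover have "size (add_mset r B) \<le> s" using arrive.hyps(1) by simp
    ultimately show ?thesis using arrive.hyps(3)[of xs'] Cons by auto
  qed
next
  case (serve q B c p)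
  have "size B \<le> s" using serve.prems by simp
  from serve.hyps(2)[OF this] obtain p' B' Z c1 c2 where *:
    "run line_dist s p' B' ys c2" "c = c1 + c2" "size B' \<le> s" "B + mset xs = B' + Z"
    "line_dist q p' \<le> c1" "\<forall>q\<in>#Z. line_dist q p' \<le> c1" by blast
  have "line_dist p p' \<le> line_dist p q + c1"
    using line_dist_triangle[of p p' q] *(5) by simp
  moreover have "\<forall>x\<in>#add_mset q Z. line_dist x p' \<le> line_dist p q + c1"
    using *(5,6) by (auto intro: add_increasing)
  ultimately show ?case using *
    by (intro exI[of _ p'] exI[of _ B'] exI[of _ "add_mset q Z"]
        exI[of _ "line_dist p q + c1"] exI[of _ c2]) auto
qed

text \<open>More than \<open>s\<close> requests at \<open>x\<close> do not fit into the buffer, so the server must visit \<open>x\<close>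
  before all of them have arrived.\<close>

lemma run_forced_visit:
  assumes "run line_dist s p B (replicate r x @ ys) c" and "size B \<le> s" and "s < r + count B x"
  shows "\<exists>B' Z j c1 c2. run line_dist s x B' (replicate j x @ ys) c2 \<and> c = c1 + c2 \<and> size B' \<le> s \<and>
           B \<subseteq># B' + Z \<and> line_dist p x \<le> c1 \<and> (\<forall>q\<in>#Z. line_dist q x \<le> c1)"
  using assms
proof (induction p B "replicate r x @ ys" c arbitrary: r rule: run.induct)
  case (finished p)
  then show ?case by simp
next
  case (arrive B p r' rs c)
  have "r \<noteq> 0" using arrive.prems arrive.hyps(1) count_le_size[of B x] by linarith
  then obtain j where j: "r = Suc j" by (cases r) auto
  then have rs: "rs = replicate j x @ ys" "r' = x" using arrive.hyps(4) by auto
  \<comment> \<open>The number of copies of \<open>x\<close> pending or still to come drops only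
    when \<open>x\<close> is served, so the hypothesis survives every other event.\<close>
  have "size (add_mset r' B) \<le> s" "s < j + count (add_mset r' B) x"
    using arrive.hyps(1) arrive.prems j rs by auto
  from arrive.hyps(3)[OF rs(1) this] obtain B' Z j c1 c2 where *:
    "run line_dist s x B' (replicate j x @ ys) c2" "c = c1 + c2" "size B' \<le> s"
    "add_mset r' B \<subseteq># B' + Z" "line_dist p x \<le> c1" "\<forall>q\<in>#Z. line_dist q x \<le> c1" by blast
  have "B \<subseteq># B' + Z" using *(4) by (rule subset_mset.order_trans[rotated]) simp
  then show ?case using * by blast
next
  case (serve q B c p)
  show ?case
  proof (cases "q = x")
    case True
    then show ?thesis using serve
      by (intro exI[of _ B] exI[of _ "{#x#}"] exI[of _ r] exI[of _ "line_dist p x"] exI[of _ c])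
        auto
  next
    case False
    have "size B \<le> s" "s < r + count B x" using serve.prems False by auto
    from serve.hyps(2)[OF refl this] obtain B' Z j c1 c2 where *:
      "run line_dist s x B' (replicate j x @ ys) c2" "c = c1 + c2" "size B' \<le> s"
      "B \<subseteq># B' + Z" "line_dist q x \<le> c1" "\<forall>q\<in>#Z. line_dist q x \<le> c1" by blast
    have "line_dist p x \<le> line_dist p q + c1"
      using line_dist_triangle[of p x q] *(5) by simp
    moreover have "\<forall>z\<in>#add_mset q Z. line_dist z x \<le> line_dist p q + c1"
      using *(5,6) by (auto intro: add_increasing)
    ultimately show ?thesis using *
      by (intro exI[of _ B'] exI[of _ "add_mset q Z"] exI[of _ j]
          exI[of _ "line_dist p q + c1"] exI[of _ c2]) auto
  qed
qed

text \<open>One segment of the run, cut at the end of \<open>xs\<close> and again at the visit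
  enforced by \<open>Suc s\<close> copies of \<open>x\<close>. Sites in \<open>Z\<close> are within
  \<open>c1\<close> of \<open>x\<close> because the server still has to go on to
  \<open>x\<close>.\<close>

lemma run_segment:
  assumes "run line_dist s p B (xs @ replicate (Suc s) x @ ys) c" and "size B \<le> s"
  obtains B' Z j c1 c2 where "run line_dist s x B' (replicate j x @ ys) c2" "c = c1 + c2" "0 \<le> c1"
    "size B' \<le> s" "B + mset xs \<subseteq># B' + Z" "\<And>q. q \<in># Z \<Longrightarrow> line_dist q x \<le> c1"
proof -
  from run_split_append[OF assms] obtain p1 B1 Z1 a b where 1:
    "run line_dist s p1 B1 (replicate (Suc s) x @ ys) b" "c = a + b" "size B1 \<le> s"
    "B + mset xs = B1 + Z1" "line_dist p p1 \<le> a" "\<forall>q\<in>#Z1. line_dist q p1 \<le> a" by blast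
  from run_forced_visit[OF 1(1,3)] obtain B' Z2 j a' b' where 2:
    "run line_dist s x B' (replicate j x @ ys) b'" "b = a' + b'" "size B' \<le> s"
    "B1 \<subseteq># B' + Z2" "line_dist p1 x \<le> a'" "\<forall>q\<in>#Z2. line_dist q x \<le> a'" by force
  have nonneg: "0 \<le> a" "0 \<le> a'"
    using 1(5) 2(5) line_dist_nonneg order_trans by blast+
  show thesis
  proof (rule that[of B' j b' "a + a'" "Z1 + Z2"])
    show "B + mset xs \<subseteq># B' + (Z1 + Z2)"
      using 2(4) unfolding 1(4) by (simp add: add.commute add.left_commute subset_mset.add_left_mono)
    show "line_dist q x \<le> a + a'" if "q \<in># Z1 + Z2" for q
      using that 1(6) 2(5,6) line_dist_triangle[of q x p1] nonneg by fastforce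
  qed (use 1 2 nonneg in auto)
qed

section \<open>Building blocks for constructing runs\<close>

lemma run_arrivals:
  assumes "run d s p (B + mset xs) ys c" and "size B + length xs \<le> s"
  shows "run d s p B (xs @ ys) c"
  using assms by (induction xs arbitrary: B) (auto intro!: run.arrive)

lemma run_serve_here:
  assumes "run line_dist s x B rs c"
  shows "run line_dist s x (B + replicate_mset j x) rs c"
proof (induction j)
  case (Suc j)
  from run.serve[OF this, of x] show ?case by simp
qed (use assms in simp)

lemma run_serve_there:
  assumes "run line_dist s x B rs c" and "0 < j"
  shows "run line_dist s p (B + replicate_mset j x) rs (line_dist p x + c)"
  using run.serve[OF run_serve_here[OF assms(1), of "j - 1"], of p] assms(2)
  by (cases j) auto

lemma run_pass_through:
  assumes "run line_dist s x B rs c" and "size B < s"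
  shows "run line_dist s x B (replicate j x @ rs) c"
proof (induction j)
  case (Suc j)
  from run.arrive[OF assms(2) run.serve[OF this, of x]] show ?case by simp
qed (use assms in simp)

section \<open>The hierarchical input\<close>

text \<open>The least multiple of \<open>2 ^ i\<close> strictly above \<open>t\<close>, also when
  \<open>t\<close> is itself a multiple.\<close>

definition next_mult :: "nat \<Rightarrow> nat \<Rightarrow> nat" where
  "next_mult i t = 2 ^ i * Suc (t div 2 ^ i)"

definition level_reqs :: "nat \<Rightarrow> nat \<Rightarrow> nat \<Rightarrow> nat list" where
  "level_reqs m l t = concat (map (\<lambda>i. if 2 ^ i dvd t then replicate m (t + 2 ^ i) else []) [0..<l])"

text \<open>The copies of \<open>t\<close> come last, so that the level requests have already
  arrived when the visit of \<open>t\<close> is forced.\<close>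

definition phase :: "nat \<Rightarrow> nat \<Rightarrow> nat \<Rightarrow> nat \<Rightarrow> nat list" where
  "phase m l K t = level_reqs m l t @ replicate K t"

definition phases :: "nat \<Rightarrow> nat \<Rightarrow> nat \<Rightarrow> nat \<Rightarrow> nat \<Rightarrow> nat list" where
  "phases m l K a N = concat (map (phase m l K) [a..<N])"

lemma phases_step: "a < N \<Longrightarrow> phases m l K a N = phase m l K a @ phases m l K (Suc a) N"
  by (simp add: phases_def upt_conv_Cons)

lemma next_mult_gt: "t < next_mult i t"
  unfolding next_mult_def using dividend_less_times_div[of "2^i" t] by simp

lemma next_mult_le: "next_mult i t \<le> t + 2 ^ i"
  unfolding next_mult_def by simp

lemma next_mult_dvd: "2 ^ i dvd t \<Longrightarrow> next_mult i t = t + 2 ^ i"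
  unfolding next_mult_def by auto

lemma next_mult_le_bound:
  assumes "t < N" and "2 ^ i dvd N"
  shows "next_mult i t \<le> N"
proof -
  obtain q where q: "N = 2 ^ i * q" using assms(2) by blast
  then have "t div 2 ^ i < q" using assms(1) by (simp add: less_mult_imp_div_less mult.commute)
  then show ?thesis unfolding next_mult_def q by (intro mult_le_mono2) simp
qed

lemma next_mult_Suc:
  "next_mult i t = (if 2 ^ i dvd Suc t then Suc t else next_mult i (Suc t))"
  unfolding next_mult_def by (simp add: div_Suc dvd_eq_mod_eq_0)
    (metis mod_0_imp_dvd dvd_mult_div_cancel div_Suc mult_Suc_right)

lemma mset_level_reqs:
  "mset (level_reqs m l t) = (\<Sum>i<l. if 2 ^ i dvd t then replicate_mset m (t + 2 ^ i) else {#})"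
  by (induction l) (auto simp: level_reqs_def)

section \<open>The large buffer sweeps\<close>

definition pending :: "nat \<Rightarrow> nat \<Rightarrow> nat \<Rightarrow> nat multiset" where
  "pending m l t = (\<Sum>i<l. replicate_mset m (next_mult i t))"

lemma size_pending: "size (pending m l t) = m * l"
  by (induction l) (auto simp: pending_def)

text \<open>Pending requests at \<open>t\<close> are served before the phase begins, which frees
  places for its arrivals. If there are none, the first new copy of \<open>t\<close> brings the
  server there.\<close>

lemma run_phase:
  assumes "run line_dist k t (B + mset (level_reqs m l t)) rs c"
    and "size (B + mset (level_reqs m l t)) < k" and "0 < K"
  shows "run line_dist k p (B + replicate_mset j t) (phase m l K t @ rs) (line_dist p t + c)"
proof -
  let ?B = "B + mset (level_reqs m l t)"
  have reach: "run line_dist k p B (phase m l K t @ rs) (line_dist p t + c)" for p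
  proof -
    obtain K' where K': "K = Suc K'" using assms(3) by (cases K) auto
    have "run line_dist k p ?B (replicate K t @ rs) (line_dist p t + c)"
      using run.arrive[OF assms(2) run.serve[OF run_pass_through[OF assms(1,2), of K'], of p]] K'
      by simp
    then show ?thesis unfolding phase_def append_assoc
      using assms(2) by (intro run_arrivals[where xs = "level_reqs m l t"]) auto
  qed
  show ?thesis
  proof (cases "j = 0")
    case True
    then show ?thesis using reach by simp
  next
    case False
    from run_serve_there[OF reach[of t], of j p] False show ?thesis by simp
  qed
qed

text \<open>The levels whose requests wait at \<open>Suc t\<close> are exactly those that get a new
  batch there; all others keep their requests, which form \<open>B\<close>.\<close>

lemma pending_Suc:
  "\<exists>B j. pending m l t = B + replicate_mset j (Suc t) \<and>
     pending m l (Suc t) = B + mset (level_reqs m l (Suc t))"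
proof (induction l)
  case (Suc l)
  then obtain B j where *: "pending m l t = B + replicate_mset j (Suc t)"
    "pending m l (Suc t) = B + mset (level_reqs m l (Suc t))" by blast
  show ?case
  proof (cases "2 ^ l dvd Suc t")
    case True
    then have nm: "next_mult l t = Suc t" "next_mult l (Suc t) = Suc t + 2 ^ l"
      using next_mult_Suc[of l t] by (simp_all add: next_mult_dvd)
    have "pending m (Suc l) t = pending m l t + replicate_mset m (Suc t)"
      by (simp add: pending_def nm)
    also have "\<dots> = B + replicate_mset (j + m) (Suc t)"
      unfolding *(1) by (simp add: multiset_eq_iff)
    finally have "pending m (Suc l) t = B + replicate_mset (j + m) (Suc t)" .
    moreover have "pending m (Suc l) (Suc t) = B + mset (level_reqs m (Suc l) (Suc t))"
      using *(2) True by (simp add: pending_def mset_level_reqs nm(2) add.assoc)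
    ultimately show ?thesis by blast
  next
    case False
    then have nm: "next_mult l t = next_mult l (Suc t)" using next_mult_Suc[of l t] by simp
    let ?B = "B + replicate_mset m (next_mult l t)"
    have "pending m (Suc l) t = ?B + replicate_mset j (Suc t)"
      using *(1) by (simp add: pending_def ac_simps)
    moreover have "pending m (Suc l) (Suc t) = ?B + mset (level_reqs m (Suc l) (Suc t))"
      using *(2) False by (simp add: pending_def mset_level_reqs nm ac_simps)
    ultimately show ?thesis by blast
  qed
qed (simp add: pending_def level_reqs_def)

lemma run_sweep:
  assumes "t < N" and "\<And>i. i < l \<Longrightarrow> 2 ^ i dvd N" and "0 < m * l" and "m * l < k" and "0 < K"
  shows "run line_dist k t (pending m l t) (phases m l K (Suc t) N) (real N - real t)"
  using assms(1)
proof (induction "N - t" arbitrary: t)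
  case (Suc d)
  show ?case
  proof (cases "Suc t = N")
    \<comment> \<open>No phase is left. As each \<open>2 ^ i\<close> divides \<open>N\<close>,
      everything pending waits at \<open>N\<close>, and a single move serves it.\<close>
    case True
    have "next_mult i t = N" if "i < l" for i
      using next_mult_Suc[of i t] assms(2)[OF that] True by simp
    then have "pending m l t = (\<Sum>i<l. replicate_mset m N)" by (simp add: pending_def)
    also have "\<dots> = replicate_mset (m * l) N"
      by (induction l) (auto simp: multiset_eq_iff)
    finally have *: "pending m l t = {#} + replicate_mset (m * l) N" by simp
    from run_serve_there[OF run.finished assms(3), of k t N] show ?thesis
      unfolding * using True by (simp add: phases_def line_dist_def)
  next
    case False
    then have lt: "Suc t < N" using Suc.prems by simp
    obtain B j where *: "pending m l t = B + replicate_mset j (Suc t)"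
      "pending m l (Suc t) = B + mset (level_reqs m l (Suc t))" using pending_Suc by blast
    have "run line_dist k (Suc t) (pending m l (Suc t)) (phases m l K (Suc (Suc t)) N)
            (real N - real (Suc t))"
      using Suc.hyps(2) lt by (intro Suc.hyps(1)) auto
    from run_phase[OF this[unfolded *] _ assms(5), of t j]
    have "run line_dist k t (pending m l t) (phases m l K (Suc t) N)
            (line_dist t (Suc t) + (real N - real (Suc t)))"
      using size_pending[of m l "Suc t"] assms(4) lt unfolding * by (simp add: phases_step)
    then show ?thesis by (simp add: line_dist_def)
  qed
qed simp

text \<open>The server walks from \<open>p\<close> to 0 and then sweeps to \<open>N\<close>.\<close>

lemma opt_cost_phases_le:
  assumes "0 < N" and "\<And>i. i < l \<Longrightarrow> 2 ^ i dvd N" and "0 < m * l" and "m * l < k" and "0 < K"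
  shows "opt_cost line_dist k p (phases m l K 0 N) \<le> real p + real N"
proof -
  have pend: "pending m l 0 = {#} + mset (level_reqs m l 0)"
    by (simp add: pending_def mset_level_reqs next_mult_dvd)
  have "run line_dist k 0 (pending m l 0) (phases m l K (Suc 0) N) (real N)"
    using run_sweep[OF assms] by simp
  from run_phase[OF this[unfolded pend] _ assms(5), of p 0]
  have "run line_dist k p {#} (phases m l K 0 N) (line_dist p 0 + real N)"
    using size_pending[of m l 0] assms(1,4) unfolding pend by (simp add: phases_step)
  then show ?thesis using opt_cost_le[of k line_dist p] assms(4) by (auto simp: line_dist_def)
qed

section \<open>The small buffer makes excursions\<close>

text \<open>Here \<open>c \<tau>\<close> is the distance travelled between the forced visits of the sites \<open>\<tau> - 1\<close>
  and \<open>\<tau>\<close>, so the sites visited meanwhile lie within \<open>c \<tau>\<close> of \<open>\<tau>\<close>. The level-\<open>i\<close> requests pending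
  in the sweep at time \<open>t\<close> arrived at the last multiple of \<open>2 ^ i\<close>; the predicate holds whenever one
  of them can have been served before the visit of \<open>t\<close>.\<close>

definition early :: "(nat \<Rightarrow> real) \<Rightarrow> nat \<Rightarrow> nat \<Rightarrow> bool" where
  "early c t i \<longleftrightarrow> (\<exists>\<tau>\<le>t. t div 2 ^ i = \<tau> div 2 ^ i \<and> real (next_mult i t) \<le> real \<tau> + c \<tau>)"

text \<open>The levels whose whole batch must still be waiting, each blocking \<open>m\<close>
  places of the small buffer.\<close>

definition late :: "nat \<Rightarrow> (nat \<Rightarrow> real) \<Rightarrow> nat \<Rightarrow> nat set" where
  "late l c t = {i. i < l \<and> \<not> early c t i}"

text \<open>Lets \<open>c\<close> be extended segment by segment without changing earlier
  times.\<close>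

lemma early_cong: "(\<And>\<tau>. \<tau> \<le> t \<Longrightarrow> c \<tau> = c' \<tau>) \<Longrightarrow> early c t i = early c' t i"
  unfolding early_def by auto

lemma count_level_reqs:
  "count (mset (level_reqs m l t)) x = m * card {i. i < l \<and> 2 ^ i dvd t \<and> next_mult i t = x}"
proof (induction l)
  case (Suc l)
  have "{i. i < Suc l \<and> 2 ^ i dvd t \<and> next_mult i t = x} =
    {i. i < l \<and> 2 ^ i dvd t \<and> next_mult i t = x} \<union>
    (if 2 ^ l dvd t \<and> next_mult l t = x then {l} else {})"
    by (auto simp: less_Suc_eq)
  then show ?case using Suc by (auto simp: mset_level_reqs next_mult_dvd)
qed (simp add: level_reqs_def)

text \<open>The invariant counts site by site, since several levels may wait at the same site and
  their requests are indistinguishable.\<close>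

lemma late_pending_step:
  assumes "\<And>x. t < x \<Longrightarrow> m * card {i \<in> late l c t. next_mult i t = x} \<le> count B x"
    and "B + mset (level_reqs m l (Suc t)) \<subseteq># B' + Z"
    and "\<And>q. q \<in># Z \<Longrightarrow> line_dist q (Suc t) \<le> c (Suc t)" and "Suc t < x"
  shows "m * card {i \<in> late l c (Suc t). next_mult i (Suc t) = x} \<le> count B' x"
proof (cases "x \<in># Z")
  case True
  \<comment> \<open>Taking \<open>Suc t\<close> for the witness in \<open>early\<close> makes every
    level waiting at \<open>x\<close> early.\<close>
  then have "real x \<le> real (Suc t) + c (Suc t)" using assms(3)[of x] by (simp add: line_dist_def)
  then have empty: "{i \<in> late l c (Suc t). next_mult i (Suc t) = x} = {}"
    by (auto simp: late_def early_def)
  show ?thesis unfolding empty by simp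
next
  case False
  \<comment> \<open>A late level either has just received its batch or has stayed in its block and
    was late before.\<close>
  have "{i \<in> late l c (Suc t). next_mult i (Suc t) = x} \<subseteq>
    {i \<in> late l c t. next_mult i t = x} \<union>
    {i. i < l \<and> 2 ^ i dvd Suc t \<and> next_mult i (Suc t) = x}"
  proof (intro subsetI)
    fix i assume i: "i \<in> {i \<in> late l c (Suc t). next_mult i (Suc t) = x}"
    show "i \<in> {i \<in> late l c t. next_mult i t = x} \<union>
      {i. i < l \<and> 2 ^ i dvd Suc t \<and> next_mult i (Suc t) = x}"
    proof (cases "2 ^ i dvd Suc t")
      case False
      then have "next_mult i t = next_mult i (Suc t)" using next_mult_Suc[of i t] by simp
      moreover from this have "t div 2 ^ i = Suc t div 2 ^ i" by (simp add: next_mult_def)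
      ultimately show ?thesis using i le_SucI by (fastforce simp: late_def early_def)
    qed (use i in \<open>auto simp: late_def\<close>)
  qed
  then have "card {i \<in> late l c (Suc t). next_mult i (Suc t) = x} \<le>
    card ({i \<in> late l c t. next_mult i t = x} \<union>
      {i. i < l \<and> 2 ^ i dvd Suc t \<and> next_mult i (Suc t) = x})"
    by (intro card_mono) (auto simp: late_def)
  also have "\<dots> \<le> card {i \<in> late l c t. next_mult i t = x} +
      card {i. i < l \<and> 2 ^ i dvd Suc t \<and> next_mult i (Suc t) = x}"
    by (rule card_Un_le)
  finally have "card {i \<in> late l c (Suc t). next_mult i (Suc t) = x} \<le>
    card {i \<in> late l c t. next_mult i t = x} +
      card {i. i < l \<and> 2 ^ i dvd Suc t \<and> next_mult i (Suc t) = x}" .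
  from mult_le_mono2[OF this, of m] have "m * card {i \<in> late l c (Suc t). next_mult i (Suc t) = x} \<le>
    m * card {i \<in> late l c t. next_mult i t = x} +
      m * card {i. i < l \<and> 2 ^ i dvd Suc t \<and> next_mult i (Suc t) = x}"
    by (simp only: add_mult_distrib2)
  also have "\<dots> \<le> count B x + count (mset (level_reqs m l (Suc t))) x"
    unfolding count_level_reqs using assms(1)[of x] assms(4) by simp
  also have "\<dots> \<le> count B' x"
    using mset_subset_eq_count[OF assms(2), of x] False by (simp add: not_in_iff)
  finally show ?thesis .
qed

text \<open>Groups the late levels by the site at which they wait and adds up the counts.\<close>

lemma card_late_le_size:
  assumes "\<And>x. t < x \<Longrightarrow> m * card {i \<in> late l c t. next_mult i t = x} \<le> count B x"
  shows "m * card (late l c t) \<le> size B"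
proof -
  let ?X = "(\<lambda>i. next_mult i t) ` late l c t"
  have fin: "finite (late l c t)" by (simp add: late_def)
  have "m * card (late l c t) = (\<Sum>x\<in>?X. m * card {i \<in> late l c t. next_mult i t = x})"
    using sum.image_gen[OF fin, of "\<lambda>_. m" "\<lambda>i. next_mult i t"] by (simp add: mult.commute)
  also have "\<dots> \<le> (\<Sum>x\<in>?X. count B x)"
    using assms next_mult_gt by (intro sum_mono) auto
  also have "\<dots> = size (filter_mset (\<lambda>x. x \<in> ?X) B)"
    unfolding size_multiset_overloaded_eq
    by (rule sum.mono_neutral_cong_right) (use fin in \<open>auto simp: not_in_iff\<close>)
  also have "\<dots> \<le> size B" by (rule size_filter_mset_lesseq)
  finally show ?thesis .
qed

text \<open>Induction on the forced visits, each adding one value of \<open>c\<close>. The bound on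
  \<open>late\<close> is recorded for all \<open>u \<le> t\<close> because earlier buffers are
  forgotten.\<close>

lemma run_phases_segments:
  assumes "run line_dist s p {#} (phases m l (Suc s) 0 N) C" and "t < N"
  shows "\<exists>c B j R. run line_dist s t B (replicate j t @ phases m l (Suc s) (Suc t) N) R \<and>
           C = (\<Sum>\<tau>\<le>t. c \<tau>) + R \<and> (\<forall>\<tau>. 0 \<le> c \<tau>) \<and> size B \<le> s \<and>
           (\<forall>u\<le>t. m * card (late l c u) \<le> s) \<and>
           (\<forall>x>t. m * card {i \<in> late l c t. next_mult i t = x} \<le> count B x)"
  using assms(2)
proof (induction t)
  case 0
  have "run line_dist s p {#} (level_reqs m l 0 @ replicate (Suc s) 0 @ phases m l (Suc s) (Suc 0) N) C"
    using assms(1) 0 by (simp add: phases_step phase_def)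
  then obtain B Z j c1 R where *:
    "run line_dist s 0 B (replicate j 0 @ phases m l (Suc s) (Suc 0) N) R" "C = c1 + R" "0 \<le> c1"
    "size B \<le> s" "{#} + mset (level_reqs m l 0) \<subseteq># B + Z" "\<And>q. q \<in># Z \<Longrightarrow> line_dist q 0 \<le> c1"
    by (rule run_segment) auto
  define c where "c = (\<lambda>\<tau>::nat. if \<tau> = 0 then c1 else 0)"
  have pend: "m * card {i \<in> late l c 0. next_mult i 0 = x} \<le> count B x" for x
  proof (cases "x \<in># Z")
    case True
    then have "real x \<le> c1" using *(6) by (fastforce simp: line_dist_def)
    then have empty: "{i \<in> late l c 0. next_mult i 0 = x} = {}"
      by (auto simp: late_def early_def c_def)
    show ?thesis unfolding empty by simp
  next
    case False
    have "card {i \<in> late l c 0. next_mult i 0 = x} \<le> card {i. i < l \<and> 2 ^ i dvd (0::nat) \<and> next_mult i 0 = x}"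
      by (intro card_mono) (auto simp: late_def)
    then have "m * card {i \<in> late l c 0. next_mult i 0 = x} \<le> count (mset (level_reqs m l 0)) x"
      unfolding count_level_reqs by (rule mult_le_mono2)
    also have "\<dots> \<le> count B x"
      using mset_subset_eq_count[OF *(5), of x] False by (simp add: not_in_iff)
    finally show ?thesis .
  qed
  have "m * card (late l c 0) \<le> s" using card_late_le_size[OF pend] *(4) by simp
  then show ?case using * pend
    by (intro exI[of _ c] exI[of _ B] exI[of _ j] exI[of _ R]) (auto simp: c_def)
next
  case (Suc t)
  then obtain c B j R where IH: "run line_dist s t B (replicate j t @ phases m l (Suc s) (Suc t) N) R"
    "C = (\<Sum>\<tau>\<le>t. c \<tau>) + R" "\<And>\<tau>. 0 \<le> c \<tau>" "size B \<le> s"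
    "\<And>u. u \<le> t \<Longrightarrow> m * card (late l c u) \<le> s"
    "\<And>x. t < x \<Longrightarrow> m * card {i \<in> late l c t. next_mult i t = x} \<le> count B x"
    by (meson Suc_lessD)
  \<comment> \<open>The copies of \<open>t\<close> left over from the last forced visit open the
    next segment.\<close>
  have "run line_dist s t B ((replicate j t @ level_reqs m l (Suc t)) @ replicate (Suc s) (Suc t) @
      phases m l (Suc s) (Suc (Suc t)) N) R"
    using IH(1) Suc.prems by (simp add: phases_step[of "Suc t"] phase_def)
  then obtain B' Z j' c1 R' where *:
    "run line_dist s (Suc t) B' (replicate j' (Suc t) @ phases m l (Suc s) (Suc (Suc t)) N) R'"
    "R = c1 + R'" "0 \<le> c1" "size B' \<le> s"
    "B + mset (replicate j t @ level_reqs m l (Suc t)) \<subseteq># B' + Z"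
    "\<And>q. q \<in># Z \<Longrightarrow> line_dist q (Suc t) \<le> c1"
    using IH(4) by (rule run_segment) blast
  define c' where "c' = c(Suc t := c1)"
  have late_eq: "late l c' u = late l c u" if "u \<le> t" for u
    unfolding late_def using that early_cong[of u c' c] by (auto simp: c'_def)
  have sub: "B + mset (level_reqs m l (Suc t)) \<subseteq># B' + Z"
    by (rule subset_mset.order_trans[OF _ *(5)]) (simp add: add.commute)
  have pend: "m * card {i \<in> late l c' (Suc t). next_mult i (Suc t) = x} \<le> count B' x"
    if "Suc t < x" for x
    using that by (intro late_pending_step[of t m l c' B, OF _ sub])
      (use IH(6) *(6) late_eq in \<open>auto simp: c'_def\<close>)
  have "m * card (late l c' (Suc t)) \<le> s" using card_late_le_size[OF pend] *(4) by simp
  then have "\<forall>u\<le>Suc t. m * card (late l c' u) \<le> s"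
    using IH(5) late_eq by (auto simp: le_Suc_eq)
  moreover have "C = (\<Sum>\<tau>\<le>Suc t. c' \<tau>) + R'"
    using IH(2) *(2) by (simp add: c'_def)
  moreover have "\<forall>\<tau>. 0 \<le> c' \<tau>" using IH(3) *(3) by (simp add: c'_def)
  ultimately show ?case using *(1,4) pend
    by (intro exI[of _ c'] exI[of _ B'] exI[of _ j'] exI[of _ R']) blast
qed

lemma run_phases_excursions:
  assumes "run line_dist s p {#} (phases m l (Suc s) 0 N) C" and "0 < N"
  obtains c where "(\<Sum>\<tau><N. c \<tau>) \<le> C" "\<And>\<tau>. 0 \<le> c \<tau>"
    "\<And>t. t < N \<Longrightarrow> m * card (late l c t) \<le> s"
proof -
  obtain T where T: "N = Suc T" using assms(2) by (cases N) auto
  from run_phases_segments[OF assms(1), of T] T obtain c B j R where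
    "run line_dist s T B (replicate j T @ phases m l (Suc s) (Suc T) N) R"
    "C = (\<Sum>\<tau>\<le>T. c \<tau>) + R" "\<forall>\<tau>. 0 \<le> c \<tau>" "\<forall>u\<le>T. m * card (late l c u) \<le> s"
    by blast
  then show thesis using run_cost_nonneg that[of c] T by (auto simp: lessThan_Suc_atMost)
qed

section \<open>The total length of the excursions\<close>

text \<open>A time is determined by its block and its distance to the block's end. There are
  \<open>N div 2 ^ i\<close> blocks and at most \<open>2 ^ i div D\<close> admissible
  distances.\<close>

lemma card_close_to_next_mult:
  assumes "2 ^ i dvd N"
  shows "D * card {t. t < N \<and> D * (next_mult i t - t) < 2 ^ i} \<le> N"
proof (cases "D = 0")
  case False
  let ?S = "{t. t < N \<and> D * (next_mult i t - t) < 2 ^ i}"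
  let ?f = "\<lambda>t. (t div 2 ^ i, next_mult i t - t)"
  have "inj_on ?f ?S"
  proof (rule inj_onI)
    fix t u assume "?f t = ?f u"
    then have "next_mult i t = next_mult i u" "next_mult i t - t = next_mult i u - u"
      by (auto simp: next_mult_def)
    then show "t = u" using next_mult_gt[of t i] next_mult_gt[of u i] by linarith
  qed
  moreover have "?f ` ?S \<subseteq> {..<N div 2 ^ i} \<times> {1..2 ^ i div D}"
  proof -
    have "t div 2 ^ i < N div 2 ^ i" if "t < N" for t
      using that assms by (simp add: less_mult_imp_div_less)
    moreover have "Suc 0 \<le> next_mult i t - t" for t using next_mult_gt[of t i] by simp
    moreover have "u \<le> 2 ^ i div D" if "D * u < 2 ^ i" for u
      using that False by (simp add: less_eq_div_iff_mult_less_eq mult.commute)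
    ultimately show ?thesis by auto
  qed
  ultimately have "card ?S \<le> card ({..<N div 2 ^ i} \<times> {1..2 ^ i div D})"
    by (intro card_inj_on_le) auto
  then have "card ?S \<le> N div 2 ^ i * (2 ^ i div D)" by simp
  then have "D * card ?S \<le> N div 2 ^ i * (D * (2 ^ i div D))"
    by (metis mult.left_commute mult_le_mono2)
  also have "\<dots> \<le> N div 2 ^ i * 2 ^ i" by (intro mult_le_mono2) simp
  also have "\<dots> \<le> N" by simp
  finally show ?thesis .
qed simp

lemma sum_powers_of_2_le:
  fixes X :: real
  assumes "0 \<le> X"
  shows "(\<Sum>i | i < l \<and> 2 ^ i \<le> X. 2 ^ i) \<le> 2 * X"
proof (induction l)
  case (Suc l)
  show ?case
  proof (cases "2 ^ l \<le> X")
    case True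
    have "(\<Sum>i | i < Suc l \<and> 2 ^ i \<le> X. 2 ^ i) \<le> (\<Sum>i<Suc l. 2 ^ i :: real)"
      by (intro sum_mono2) auto
    also have "\<dots> = 2 ^ Suc l - 1" by (induction l) auto
    also have "\<dots> \<le> 2 * X" using True by simp
    finally show ?thesis .
  next
    case False
    then have "{i. i < Suc l \<and> 2 ^ i \<le> X} = {i. i < l \<and> 2 ^ i \<le> X}"
      by (auto simp: less_Suc_eq)
    then show ?thesis using Suc by simp
  qed
qed (use assms in simp)

text \<open>Pairs \<open>(t, i)\<close> with \<open>t\<close> in the last \<open>1 / D\<close> of its block of length \<open>2 ^ i\<close> are discarded. For the
  other ones an excursion of length \<open>c \<tau>\<close> only helps levels with \<open>2 ^ i \<le> D * c \<tau>\<close>, and level \<open>i\<close>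
  at most \<open>2 ^ i\<close> times: a geometric sum.\<close>

lemma card_early_le:
  fixes c :: "nat \<Rightarrow> real"
  assumes "\<And>\<tau>. 0 \<le> c \<tau>" and "\<And>i. i < l \<Longrightarrow> 2 ^ i dvd N" and "0 < D"
  shows "real (card {(t, i). t < N \<and> i < l \<and> early c t i})
           \<le> real l * real N / real D + 2 * real D * (\<Sum>\<tau><N. c \<tau>)"
proof -
  let ?bad = "\<lambda>i. {t. t < N \<and> D * (next_mult i t - t) < 2 ^ i}"
  let ?lev = "\<lambda>\<tau>. {i. i < l \<and> 2 ^ i \<le> real D * c \<tau>}"
  let ?Bad = "(\<Union>i<l. ?bad i \<times> {i})"
  \<comment> \<open>An excursion at \<open>\<tau>\<close> helps level \<open>i\<close> only until
    the block of \<open>\<tau>\<close> ends.\<close>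
  let ?Good = "(\<Union>\<tau><N. \<Union>i\<in>?lev \<tau>. {\<tau>..<next_mult i \<tau>} \<times> {i})"
  have "{(t, i). t < N \<and> i < l \<and> early c t i} \<subseteq> ?Bad \<union> ?Good"
  proof (clarify)
    fix t i assume ti: "t < N" "i < l" "early c t i" and "(t, i) \<notin> ?Good"
    show "(t, i) \<in> ?Bad"
    proof (rule ccontr)
      assume "(t, i) \<notin> ?Bad"
      then have good: "2 ^ i \<le> D * (next_mult i t - t)" using ti by auto
      obtain \<tau> where \<tau>: "\<tau> \<le> t" "t div 2 ^ i = \<tau> div 2 ^ i" "real (next_mult i t) \<le> real \<tau> + c \<tau>"
        using ti(3) by (auto simp: early_def)
      have eq: "next_mult i \<tau> = next_mult i t" using \<tau>(2) by (simp add: next_mult_def)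
      have gt: "t < next_mult i t" by (rule next_mult_gt)
      \<comment> \<open>The excursion at \<open>\<tau> \<le> t\<close> must span the distance from
        \<open>t\<close> to the next multiple, which is at least \<open>2 ^ i / D\<close> for a pair
        outside \<open>?Bad\<close>.\<close>
      have "(2::real) ^ i \<le> real (D * (next_mult i t - t))" using good by (metis of_nat_le_iff of_nat_numeral of_nat_power)
      also have "\<dots> = real D * (real (next_mult i t) - real t)" using gt by (simp add: of_nat_diff)
      also have "\<dots> \<le> real D * c \<tau>" using \<tau> by (intro mult_left_mono) auto
      finally have "i \<in> ?lev \<tau>" using ti by simp
      moreover have "\<tau> \<in> {..<N}" "t \<in> {\<tau>..<next_mult i \<tau>}" using ti \<tau>(1) eq gt by auto
      ultimately have "(t, i) \<in> ?Good" by blast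
      then show False using \<open>(t, i) \<notin> ?Good\<close> by contradiction
    qed
  qed
  then have "card {(t, i). t < N \<and> i < l \<and> early c t i} \<le> card (?Bad \<union> ?Good)"
    by (intro card_mono) auto
  also have "\<dots> \<le> card ?Bad + card ?Good" by (rule card_Un_le)
  finally have "real (card {(t, i). t < N \<and> i < l \<and> early c t i}) \<le> real (card ?Bad) + real (card ?Good)"
    by linarith
  moreover have "real (card ?Bad) \<le> real l * real N / real D"
  proof -
    have "card ?Bad \<le> (\<Sum>i<l. card (?bad i \<times> {i}))" by (intro card_UN_le) simp
    then have "real (card ?Bad) \<le> (\<Sum>i<l. real (card (?bad i)))"
      by (simp add: card_cartesian_product flip: of_nat_sum)
    also have "\<dots> \<le> (\<Sum>i<l. real N / real D)"
    proof (intro sum_mono)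
      fix i assume "i \<in> {..<l}"
      then have "D * card (?bad i) \<le> N" using assms(2) by (intro card_close_to_next_mult) simp
      then have "real D * real (card (?bad i)) \<le> real N" by (metis of_nat_le_iff of_nat_mult)
      then show "real (card (?bad i)) \<le> real N / real D"
        using assms(3) by (simp add: field_simps)
    qed
    finally show ?thesis by simp
  qed
  moreover have "real (card ?Good) \<le> 2 * real D * (\<Sum>\<tau><N. c \<tau>)"
  proof -
    have "card ?Good \<le> (\<Sum>\<tau><N. card (\<Union>i\<in>?lev \<tau>. {\<tau>..<next_mult i \<tau>} \<times> {i}))"
      by (intro card_UN_le) simp
    also have "\<dots> \<le> (\<Sum>\<tau><N. \<Sum>i\<in>?lev \<tau>. card ({\<tau>..<next_mult i \<tau>} \<times> {i}))"
      by (intro sum_mono card_UN_le) simp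
    also have "\<dots> \<le> (\<Sum>\<tau><N. \<Sum>i\<in>?lev \<tau>. 2 ^ i)"
    proof (intro sum_mono)
      fix \<tau> i
      show "card ({\<tau>..<next_mult i \<tau>} \<times> {i}) \<le> 2 ^ i"
        using next_mult_le[of i \<tau>] by (simp add: card_cartesian_product)
    qed
    finally have "real (card ?Good) \<le> real (\<Sum>\<tau><N. \<Sum>i\<in>?lev \<tau>. 2 ^ i)"
      by (simp only: of_nat_le_iff)
    also have "\<dots> = (\<Sum>\<tau><N. \<Sum>i\<in>?lev \<tau>. 2 ^ i)" by simp
    also have "\<dots> \<le> (\<Sum>\<tau><N. 2 * (real D * c \<tau>))"
      using assms(1) by (intro sum_mono sum_powers_of_2_le) simp
    finally show ?thesis by (simp add: sum_distrib_left mult.assoc)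
  qed
  ultimately show ?thesis by linarith
qed

text \<open>Double counting of the early pairs: since late levels fill the buffer, each time has at
  least \<open>\<epsilon> * l\<close> early levels, while \<open>card_early_le\<close> bounds their
  total number.\<close>

lemma run_phases_cost_ge:
  assumes "run line_dist s p {#} (phases m l (Suc s) 0 N) C" and "0 < N"
    and "\<And>i. i < l \<Longrightarrow> 2 ^ i dvd N" and "0 < m" and "real s \<le> (1 - \<epsilon>) * real (m * l)"
    and "0 < D"
  shows "(\<epsilon> - 1 / real D) * real l * real N \<le> 2 * real D * C"
proof -
  obtain c where c: "(\<Sum>\<tau><N. c \<tau>) \<le> C" "\<And>\<tau>. 0 \<le> c \<tau>"
    "\<And>t. t < N \<Longrightarrow> m * card (late l c t) \<le> s"
    using run_phases_excursions[OF assms(1,2)] by blast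
  have many: "\<epsilon> * real l \<le> real (card {i. i < l \<and> early c t i})" if "t < N" for t
  proof -
    have "real (m * card (late l c t)) \<le> real s" using c(3)[OF that] by (simp only: of_nat_le_iff)
    then have "real m * real (card (late l c t)) \<le> real m * ((1 - \<epsilon>) * real l)"
      using assms(5) by (simp add: mult.left_commute)
    then have "real (card (late l c t)) \<le> (1 - \<epsilon>) * real l" using assms(4) by simp
    moreover have "card {i. i < l \<and> early c t i} + card (late l c t) = l"
    proof -
      have "card {i. i < l \<and> early c t i} + card (late l c t) =
        card ({i. i < l \<and> early c t i} \<union> late l c t)"
        by (rule card_Un_disjoint[symmetric]) (auto simp: late_def)
      also have "{i. i < l \<and> early c t i} \<union> late l c t = {..<l}" by (auto simp: late_def)
      finally show ?thesis by simp
    qed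
    ultimately show ?thesis by (simp add: algebra_simps flip: of_nat_add)
  qed
  have "(\<Sum>t<N. \<epsilon> * real l) \<le> (\<Sum>t<N. real (card {i. i < l \<and> early c t i}))"
    using many by (intro sum_mono) simp
  also have "\<dots> = real (card (SIGMA t:{..<N}. {i. i < l \<and> early c t i}))"
    by (simp add: card_SigmaI)
  also have "(SIGMA t:{..<N}. {i. i < l \<and> early c t i}) = {(t, i). t < N \<and> i < l \<and> early c t i}"
    by auto
  also have "real (card \<dots>) \<le> real l * real N / real D + 2 * real D * (\<Sum>\<tau><N. c \<tau>)"
    using c(2) assms(3,6) by (rule card_early_le)
  also have "\<dots> \<le> real l * real N / real D + 2 * real D * C"
    using c(1) by (simp add: mult_left_mono)
  finally show ?thesis by (simp add: algebra_simps)
qed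

section \<open>Positive costs and the ratio of the optima\<close>

lemma set_phases:
  assumes "\<And>i. i < l \<Longrightarrow> 2 ^ i dvd N"
  shows "set (phases m l K 0 N) \<subseteq> {..N}"
proof -
  have "t + 2 ^ i \<le> N" if "t < N" "i < l" "2 ^ i dvd t" for t i
    using next_mult_le_bound[OF that(1) assms[OF that(2)]] next_mult_dvd[OF that(3)] by simp
  then show ?thesis by (auto simp: phases_def phase_def level_reqs_def split: if_splits)
qed

text \<open>One of these two sites differs from the start, so the optimal cost is positive.\<close>

lemma endpoints_in_phases:
  assumes "\<And>i. i < l \<Longrightarrow> 2 ^ i dvd N" and "0 < N" and "0 < m" and "0 < l" and "0 < K"
  shows "0 \<in> set (phases m l K 0 N)" and "N \<in> set (phases m l K 0 N)"
proof -
  show "0 \<in> set (phases m l K 0 N)"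
    using assms by (auto simp: phases_def phase_def intro!: bexI[of _ 0])
  \<comment> \<open>Level 0 at time \<open>N - 1\<close> asks for \<open>N\<close>.\<close>
  have "N \<in> set (level_reqs m l (N - 1))"
    using assms by (auto simp: level_reqs_def intro!: bexI[of _ 0])
  then show "N \<in> set (phases m l K 0 N)"
    using assms by (auto simp: phases_def phase_def intro!: bexI[of _ "N - 1"])
qed

lemma opt_cost_pos:
  assumes "0 < s" and "q \<in> set rs" and "q \<noteq> p"
  shows "0 < opt_cost line_dist s p rs"
proof -
  have "line_dist p q \<le> opt_cost line_dist s p rs"
    using run_cost_ge_dist[OF opt_cost_attained[OF assms(1)]] assms(2) by simp
  moreover have "0 < line_dist p q" using assms(3) by (simp add: line_dist_def)
  ultimately show ?thesis by simp
qed

lemma opt_cost_ratio_phases: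
  fixes \<delta> :: real
  assumes \<delta>: "0 < \<delta>" "\<delta> < 1" and D: "4 / \<delta> \<le> real D" and k: "4 \<le> \<delta> * real k"
    and l: "0 < l" "l \<le> Suc e" "real l \<le> \<delta> * real k / 4" and p: "p < 2 * 2 ^ e"
  defines "s \<equiv> nat \<lceil>(1 - \<delta>) * real k\<rceil>"
  defines "rs \<equiv> phases ((k - 1) div l) l (Suc s) 0 (2 ^ e)"
  shows "set rs \<subseteq> {..2 ^ e}" and "0 < opt_cost line_dist k p rs"
    and "\<delta> * real l / (24 * real D) \<le> opt_cost line_dist s p rs / opt_cost line_dist k p rs"
proof -
  \<comment> \<open>Using \<open>k - 1\<close> keeps one place free for the sweep.\<close>
  define m where "m = (k - 1) div l"
  define N :: nat where "N = 2 ^ e"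
  have rs: "rs = phases m l (Suc s) 0 N" by (simp add: rs_def m_def N_def)
  have dvd: "2 ^ i dvd N" if "i < l" for i
    unfolding N_def using that l(2) by (intro le_imp_power_dvd) simp
  have N: "0 < N" by (simp add: N_def)
  have \<delta>k: "\<delta> * real k < real k" using \<delta> k by (smt (verit) mult_less_cancel_right2 mult_nonneg_nonpos)
  then have lk: "l < k" using l(3) k by linarith
  then have "1 \<le> (k - 1) div l" using l(1) by (simp add: less_eq_div_iff_mult_less_eq)
  then have m: "0 < m" by (simp add: m_def)
  have "m * l \<le> k - 1" by (simp add: m_def)
  then have ml: "m * l < k" using lk by simp
  have "k - 1 = m * l + (k - 1) mod l" by (simp add: m_def)
  moreover have "(k - 1) mod l < l" using l(1) by simp
  ultimately have "k \<le> m * l + l" by linarith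
  then have "real k \<le> real (m * l + l)" by (simp only: of_nat_le_iff)
  then have ml': "real k - real l \<le> real (m * l)" by simp
  have s0: "0 < s" using \<delta> lk by (simp add: s_def)
  have s1: "real s \<le> (1 - \<delta>) * real k + 1" using \<delta> by (simp add: s_def)
  \<comment> \<open>Rounding costs 1 in \<open>s\<close> and at most \<open>l\<close> in
    \<open>m * l\<close>, together at most \<open>\<delta> * k / 2\<close>. Half of the deficit
    remains, so \<open>\<epsilon> = \<delta> / 2\<close>.\<close>
  have "s \<le> (1 - \<delta> / 2) * real (m * l)"
  proof -
    have "real s \<le> real k - \<delta> * real k + 1" using s1 by (simp add: algebra_simps)
    also have "\<dots> \<le> real k - \<delta> * real k / 2 - real l" using l(3) k by linarith
    also have "\<dots> \<le> real k - \<delta> * real k / 2 - real l + \<delta> * real l / 2" using \<delta> by simp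
    also have "\<dots> = (1 - \<delta> / 2) * (real k - real l)" by (simp add: field_simps)
    also have "\<dots> \<le> (1 - \<delta> / 2) * real (m * l)"
      using ml' \<delta> by (intro mult_left_mono) auto
    finally show ?thesis .
  qed
  moreover have D0: "0 < D" using D \<delta> by (metis of_nat_0_less_iff divide_pos_pos less_le_trans zero_less_numeral)
  ultimately have "(\<delta> / 2 - 1 / real D) * real l * real N \<le> 2 * real D * opt_cost line_dist s p rs"
    using run_phases_cost_ge[OF opt_cost_attained[OF s0, of line_dist p rs, unfolded rs] N dvd m]
    unfolding rs by simp
  \<comment> \<open>The choice of \<open>D\<close> makes the discarded pairs cost at most half of
    \<open>\<delta> / 2\<close>.\<close>
  moreover have "\<delta> / 4 \<le> \<delta> / 2 - 1 / real D"
    using D \<delta> D0 by (simp add: field_simps)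
  then have "\<delta> / 4 * (real l * real N) \<le> (\<delta> / 2 - 1 / real D) * (real l * real N)"
    by (intro mult_right_mono) auto
  ultimately have low: "\<delta> / 4 * (real l * real N) \<le> 2 * real D * opt_cost line_dist s p rs"
    unfolding mult.assoc[of _ "real l" "real N"] by (rule order_trans[rotated])
  show "set rs \<subseteq> {..2 ^ e}" using set_phases[OF dvd] unfolding rs N_def by blast
  show pos: "0 < opt_cost line_dist k p rs"
  proof (cases "p = 0")
    case True
    then show ?thesis
      using endpoints_in_phases(2)[OF dvd N m l(1)] N lk unfolding rs by (intro opt_cost_pos[of _ N]) auto
  next
    case False
    then show ?thesis
      using endpoints_in_phases(1)[OF dvd N m l(1)] lk unfolding rs by (intro opt_cost_pos[of _ 0]) auto
  qed
  have "opt_cost line_dist k p rs \<le> real p + real N"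
    unfolding rs using N dvd m l(1) ml by (intro opt_cost_phases_le) auto
  \<comment> \<open>The start lies on a line of at most \<open>2 * N\<close> sites.\<close>
  also have "\<dots> \<le> 3 * real N"
  proof -
    have "p \<le> 2 * N" using p by (simp add: N_def)
    then show ?thesis by linarith
  qed
  finally have up: "opt_cost line_dist k p rs \<le> 3 * real N" .
  have "\<delta> * real l / (24 * real D) * opt_cost line_dist k p rs \<le> \<delta> * real l / (24 * real D) * (3 * real N)"
    using up \<delta> by (intro mult_left_mono) auto
  also have "\<dots> \<le> opt_cost line_dist s p rs"
    using low D0 by (simp add: field_simps)
  finally show "\<delta> * real l / (24 * real D) \<le> opt_cost line_dist s p rs / opt_cost line_dist k p rs"
    using pos by (simp add: pos_le_divide_eq)
qed

text \<open>The start \<open>p\<close> is arbitrary, and rounding the smaller capacity up favours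
  the small buffer. Positivity of the denominator for \<open>2 \<le> n\<close> keeps the quotient
  from being a division by zero.\<close>

theorem theorem1:
  fixes \<delta> :: real
  assumes "0 < \<delta>" and "\<delta> < 1"
  shows "\<exists>c>0. \<forall>n\<ge>1. \<forall>k\<ge>1. \<forall>p<n. \<exists>rs :: nat list.
           set rs \<subseteq> {..<n} \<and>
           (2 \<le> n \<longrightarrow> 0 < opt_cost line_dist k p rs) \<and>
           opt_cost line_dist (nat \<lceil>(1 - \<delta>) * real k\<rceil>) p rs / opt_cost line_dist k p rs
             \<ge> c * min (real k) (log 2 (real n))"
proof -
  define D where "D = nat \<lceil>4 / \<delta>\<rceil>"
  have D: "4 / \<delta> \<le> real D" unfolding D_def by linarith
  have "4 \<le> 4 / \<delta>" using assms by (simp add: pos_le_divide_eq)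
  then have D4: "4 \<le> real D" using D by linarith
  \<comment> \<open>Here \<open>192 = 24 * 8\<close>: the ratio is at least
    \<open>\<delta> * l / (24 * D)\<close>, and \<open>l\<close> will be at least
    \<open>\<delta> / 8\<close> times the minimum.\<close>
  define c where "c = \<delta>\<^sup>2 / (192 * real D)"
  have c0: "0 < c" using assms D4 by (simp add: c_def)
  have c\<delta>: "c \<le> \<delta> / 4"
  proof -
    have "c \<le> \<delta>\<^sup>2 / 4" unfolding c_def using D4 by (intro divide_left_mono) auto
    also have "\<dots> \<le> \<delta> / 4" using assms by (simp add: power2_eq_square mult_left_le)
    finally show ?thesis .
  qed
  have "\<exists>rs :: nat list. set rs \<subseteq> {..<n} \<and> (2 \<le> n \<longrightarrow> 0 < opt_cost line_dist k p rs) \<and>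
           opt_cost line_dist (nat \<lceil>(1 - \<delta>) * real k\<rceil>) p rs / opt_cost line_dist k p rs
             \<ge> c * min (real k) (log 2 (real n))"
    if n1: "1 \<le> n" and k1: "1 \<le> k" and p: "p < n" for n k p :: nat
  proof -
    define s where "s = nat \<lceil>(1 - \<delta>) * real k\<rceil>"
    consider "n = 1" | "2 \<le> n" "\<delta> * real k < 4" | "2 \<le> n" "4 \<le> \<delta> * real k" using n1 by linarith
    then show ?thesis
    proof cases
      case 1
      \<comment> \<open>As \<open>log 2 1 = 0\<close>, the claim becomes
        \<open>0 \<le> 0 / 0\<close>, where \<open>0 / 0 = 0\<close>.\<close>
      have "opt_cost line_dist a p [] = 0" if "0 < a" for a
        using opt_cost_attained[OF that, of line_dist p "[]"] by cases auto
      moreover have "0 < s" using assms k1 by (simp add: s_def)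
      ultimately show ?thesis using 1 k1 by (intro exI[of _ "[]"]) (simp flip: s_def)
    next
      \<comment> \<open>For such small \<open>k\<close> a ratio of 1 suffices; monotonicity in the
        capacity gives it for a single request away from \<open>p\<close>.\<close>
      case 2
      obtain q where q: "q < n" "q \<noteq> p"
        using 2(1) that[of "if p = 0 then 1 else 0"] by simp
      have "s \<le> k" unfolding s_def using assms k1
        by (simp add: nat_le_iff ceiling_le_iff mult_left_le_one_le)
      moreover have "0 < s" using assms k1 by (simp add: s_def)
      ultimately have "opt_cost line_dist k p [q] \<le> opt_cost line_dist s p [q]"
        by (intro opt_cost_antimono) auto
      moreover have pos: "0 < opt_cost line_dist k p [q]"
        using q k1 by (intro opt_cost_pos[of _ q]) auto
      ultimately have "1 \<le> opt_cost line_dist s p [q] / opt_cost line_dist k p [q]" by simp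
      moreover have "c * min (real k) (log 2 (real n)) \<le> 1"
      proof -
        have "c * min (real k) (log 2 (real n)) \<le> c * real k" using c0 by simp
        also have "\<dots> \<le> \<delta> / 4 * real k" using c\<delta> by (intro mult_right_mono) auto
        finally show ?thesis using 2(2) by simp
      qed
      ultimately have "c * min (real k) (log 2 (real n)) \<le>
          opt_cost line_dist s p [q] / opt_cost line_dist k p [q]" by linarith
      then show ?thesis using q pos by (intro exI[of _ "[q]"]) (simp flip: s_def)
    next
      case 3
      \<comment> \<open>The sweep uses the sites from 0 to \<open>2 ^ e\<close>, hence
        \<open>n - 1\<close>.\<close>
      obtain e where e: "2 ^ e \<le> n - 1" "n - 1 < 2 ^ (e + 1)"
        using ex_power_ivl1[of 2 "n - 1"] 3(1) by (metis le_diff_conv2 n1 nat_1_add_1 order_refl)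
      then have n: "n \<le> 2 * 2 ^ e" "2 ^ e < n" using n1 by auto
      define y where "y = \<delta> * real k / 4"
      \<comment> \<open>Levels up to \<open>e\<close> divide \<open>2 ^ e\<close>, and
        \<open>l \<le> y\<close> keeps the rounding loss small.\<close>
      define l where "l = min (Suc e) (nat \<lfloor>y\<rfloor>)"
      have y: "1 \<le> y" using 3(2) by (simp add: y_def)
      have l: "0 < l" "l \<le> Suc e" "real l \<le> y"
        using y by (auto simp: l_def min_def) linarith+
      let ?rs = "phases ((k - 1) div l) l (Suc s) 0 (2 ^ e)"
      have p': "p < 2 * 2 ^ e" using p n by simp
      note * = opt_cost_ratio_phases[OF assms D 3(2) l(1,2) l(3)[unfolded y_def] p', folded s_def]
      have "log 2 (real n) \<le> real (Suc e)"
      proof -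
        have "real n \<le> real (2 * 2 ^ e)" using n(1) by (simp only: of_nat_le_iff)
        then have "real n \<le> 2 powr real (Suc e)" by (simp add: powr_realpow powr_add)
        then show ?thesis using n1 by (simp add: log_le_iff)
      qed
      moreover have "0 \<le> log 2 (real n)" using n1 by simp
      then have "\<delta> / 8 * log 2 (real n) \<le> 1 * log 2 (real n)"
        using assms by (intro mult_right_mono) auto
      moreover have "1 \<le> \<lfloor>y\<rfloor>" using y by simp
      \<comment> \<open>Rounding down at most halves a number that is at least 1.\<close>
      then have "y / 2 \<le> real (nat \<lfloor>y\<rfloor>)" by linarith
      moreover have "\<delta> / 8 * min (real k) (log 2 (real n)) \<le> \<delta> / 8 * log 2 (real n)"
        using assms by (intro mult_left_mono) auto
      moreover have "\<delta> / 8 * min (real k) (log 2 (real n)) \<le> \<delta> / 8 * real k"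
        using assms by (intro mult_left_mono) auto
      then have "\<delta> / 8 * min (real k) (log 2 (real n)) \<le> y / 2"
        by (simp add: y_def)
      ultimately have "\<delta> / 8 * min (real k) (log 2 (real n)) \<le> real (Suc e)"
        and "\<delta> / 8 * min (real k) (log 2 (real n)) \<le> real (nat \<lfloor>y\<rfloor>)" by linarith+
      then have "\<delta> / 8 * min (real k) (log 2 (real n)) \<le> real l"
        unfolding l_def by (simp only: of_nat_min min.bounded_iff)
      then have "\<delta> * (\<delta> / 8 * min (real k) (log 2 (real n))) / (24 * real D) \<le> \<delta> * real l / (24 * real D)"
        using assms by (intro divide_right_mono mult_left_mono) auto
      then have "c * min (real k) (log 2 (real n)) \<le> \<delta> * real l / (24 * real D)"
        by (simp add: c_def power2_eq_square)
      then have "c * min (real k) (log 2 (real n)) \<le> opt_cost line_dist s p ?rs / opt_cost line_dist k p ?rs"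
        using *(3) by linarith
      moreover have "set ?rs \<subseteq> {..<n}" using *(1) n(2) by auto
      ultimately show ?thesis using *(2) by (intro exI[of _ ?rs]) (simp flip: s_def)
    qed
  qed
  then show ?thesis using c0 by blast
qed

end
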